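(* Let $R$ be a (semiperfect) ring with a Nakayama permutation and essential socles, and let $e\in R$ be an idempotent. Then $eR(1-e)=0$ if and only if $(1-e)Re=0$.
   Context: Rings are associative with unity, not necessarily commutative. "Essential socles" means that the right socle of $R$ is an essential submodule of $R_R$ and the left socle is an essential submodule of ${}_RR$. Nakayama permutation: Let $R$ be a semiperfect ring with Jacobson radical $J(R)$, and let $e_1,\dots,e_m$ be a complete set of pairwise orthogonal primitive idempotents, ordered so that for some $k\le m$ the modules $e_1R,\dots,e_kR$ are pairwise non-isomorphic and for each $k<i\le m$ there is $j\le k$ with $e_iR\cong e_jR$ (equivalently $Re_i\cong Re_j$). Put $\mathrm{top}(e_iR)=e_iR/e_iJ(R)$, $\mathrm{top}(Re_i)=Re_i/J(R)e_i$; $\mathrm{soc}$ denotes the socle. A permutation $\pi$ of $\{1,\dots,k\}$ is a Nakayama permutation if for all $i\le k$: $\mathrm{soc}(e_iR)\cong \mathrm{top}(e_{\pi(i)}R)$ and $\mathrm{soc}(Re_{\pi(i)})\cong\mathrm{top}(Re_i)$. *)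

theory Defs
  imports
    "HOL-Algebra.Module"
    "HOL-Algebra.QuotRing"
    "HOL-Algebra.Generated_Groups"
    "HOL-Combinatorics.Permutations"
begin

text \<open>
  The locale \<^locale>\<open>module\<close> asks for a commutative ring of scalars, so it is not used.
  One-sided modules over a ring \<open>R\<close> are \<open>module\<close> records whose operation \<open>a \<odot> x\<close> is
  the product \<open>x a\<close> for a right module and \<open>a x\<close> for a left module. Submodules, quotients,
  isomorphisms and socles only depend on which maps \<open>x \<mapsto> a \<odot> x\<close> with \<open>a \<in> carrier R\<close>
  act, so they are defined once for both sides. The fields \<open>mult\<close> and \<open>one\<close>, which the
  record type inherits from rings, play no role in a module.
\<close>

definition right_regular :: "('a, 'b) ring_scheme \<Rightarrow> ('a, 'a) module" where
  "right_regular R = \<lparr>carrier = carrier R, monoid.mult = (\<otimes>\<^bsub>R\<^esub>), one = one R, zero = zero R,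
     add = add R, smult = (\<lambda>a x. x \<otimes>\<^bsub>R\<^esub> a)\<rparr>"

definition left_regular :: "('a, 'b) ring_scheme \<Rightarrow> ('a, 'a) module" where
  "left_regular R = \<lparr>carrier = carrier R, monoid.mult = (\<otimes>\<^bsub>R\<^esub>), one = one R, zero = zero R,
     add = add R, smult = (\<lambda>a x. a \<otimes>\<^bsub>R\<^esub> x)\<rparr>"

definition quotient_module ::
    "('a, 'c, 'd) module_scheme \<Rightarrow> 'c set \<Rightarrow> ('a, 'c set) module" where
  "quotient_module M N = \<lparr>carrier = a_rcosets\<^bsub>M\<^esub> N, monoid.mult = rcoset_mult M N,
     one = N +>\<^bsub>M\<^esub> \<one>\<^bsub>M\<^esub>, zero = N, add = set_add M,
     smult = (\<lambda>a X. \<Union>x\<in>X. N +>\<^bsub>M\<^esub> (a \<odot>\<^bsub>M\<^esub> x))\<rparr>"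

definition module_isomorphic ::
    "('a, 'b) ring_scheme \<Rightarrow> ('a, 'c, 'd) module_scheme \<Rightarrow> ('a, 'e, 'f) module_scheme \<Rightarrow> bool"
  where
  "module_isomorphic R M N \<longleftrightarrow>
     (\<exists>h \<in> iso (add_monoid M) (add_monoid N).
        \<forall>a \<in> carrier R. \<forall>x \<in> carrier M. h (a \<odot>\<^bsub>M\<^esub> x) = a \<odot>\<^bsub>N\<^esub> h x)"

definition simple_submodule ::
    "'c set \<Rightarrow> ('a, 'b) ring_scheme \<Rightarrow> ('a, 'c, 'd) module_scheme \<Rightarrow> bool" where
  "simple_submodule S R M \<longleftrightarrow> submodule S R M \<and> S \<noteq> {\<zero>\<^bsub>M\<^esub>} \<and>
     (\<forall>L. submodule L R M \<and> L \<subseteq> S \<longrightarrow> L = {\<zero>\<^bsub>M\<^esub>} \<or> L = S)"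

definition maximal_submodule ::
    "'c set \<Rightarrow> ('a, 'b) ring_scheme \<Rightarrow> ('a, 'c, 'd) module_scheme \<Rightarrow> bool" where
  "maximal_submodule N R M \<longleftrightarrow> submodule N R M \<and> N \<noteq> carrier M \<and>
     (\<forall>L. submodule L R M \<and> N \<subseteq> L \<longrightarrow> L = N \<or> L = carrier M)"

definition essential_submodule ::
    "'c set \<Rightarrow> ('a, 'b) ring_scheme \<Rightarrow> ('a, 'c, 'd) module_scheme \<Rightarrow> bool" where
  "essential_submodule N R M \<longleftrightarrow> submodule N R M \<and>
     (\<forall>L. submodule L R M \<and> L \<noteq> {\<zero>\<^bsub>M\<^esub>} \<longrightarrow> N \<inter> L \<noteq> {\<zero>\<^bsub>M\<^esub>})"

text \<open>The additive subgroup generated by a union of submodules is the sum of these submodules.\<close>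

definition socle :: "('a, 'b) ring_scheme \<Rightarrow> ('a, 'c, 'd) module_scheme \<Rightarrow> 'c set" where
  "socle R M = generate (add_monoid M) (\<Union>{S. simple_submodule S R M})"

definition semisimple_module ::
    "('a, 'b) ring_scheme \<Rightarrow> ('a, 'c, 'd) module_scheme \<Rightarrow> bool" where
  "semisimple_module R M \<longleftrightarrow> socle R M = carrier M"

text \<open>The intersection of all maximal right ideals; it is \<open>carrier R\<close> for the zero ring.\<close>

definition jacobson_radical :: "('a, 'b) ring_scheme \<Rightarrow> 'a set" where
  "jacobson_radical R =
     {x \<in> carrier R. \<forall>N. maximal_submodule N R (right_regular R) \<longrightarrow> x \<in> N}"

definition idempotent_elem :: "('a, 'b) ring_scheme \<Rightarrow> 'a \<Rightarrow> bool" where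
  "idempotent_elem R e \<longleftrightarrow> e \<in> carrier R \<and> e \<otimes>\<^bsub>R\<^esub> e = e"

definition primitive_idempotent :: "('a, 'b) ring_scheme \<Rightarrow> 'a \<Rightarrow> bool" where
  "primitive_idempotent R e \<longleftrightarrow> idempotent_elem R e \<and> e \<noteq> \<zero>\<^bsub>R\<^esub> \<and>
     (\<forall>f g. idempotent_elem R f \<and> idempotent_elem R g \<and>
        f \<otimes>\<^bsub>R\<^esub> g = \<zero>\<^bsub>R\<^esub> \<and> g \<otimes>\<^bsub>R\<^esub> f = \<zero>\<^bsub>R\<^esub> \<and> e = f \<oplus>\<^bsub>R\<^esub> g
        \<longrightarrow> f = \<zero>\<^bsub>R\<^esub> \<or> g = \<zero>\<^bsub>R\<^esub>)"

text \<open>\<open>R / J(R)\<close> is a semisimple ring and idempotents lift modulo \<open>J(R)\<close>.\<close>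

definition semiperfect :: "('a, 'b) ring_scheme \<Rightarrow> bool" where
  "semiperfect R \<longleftrightarrow> ring R \<and>
     semisimple_module (R Quot jacobson_radical R) (right_regular (R Quot jacobson_radical R)) \<and>
     (\<forall>a \<in> carrier R. a \<otimes>\<^bsub>R\<^esub> a \<ominus>\<^bsub>R\<^esub> a \<in> jacobson_radical R \<longrightarrow>
        (\<exists>e. idempotent_elem R e \<and> e \<ominus>\<^bsub>R\<^esub> a \<in> jacobson_radical R))"

definition right_proj :: "('a, 'b) ring_scheme \<Rightarrow> 'a \<Rightarrow> ('a, 'a) module" where
  "right_proj R e = (right_regular R)\<lparr>carrier := e <#\<^bsub>R\<^esub> carrier R\<rparr>"

definition left_proj :: "('a, 'b) ring_scheme \<Rightarrow> 'a \<Rightarrow> ('a, 'a) module" where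
  "left_proj R e = (left_regular R)\<lparr>carrier := carrier R #>\<^bsub>R\<^esub> e\<rparr>"

definition right_top :: "('a, 'b) ring_scheme \<Rightarrow> 'a \<Rightarrow> ('a, 'a set) module" where
  "right_top R e = quotient_module (right_proj R e) (e <#\<^bsub>R\<^esub> jacobson_radical R)"

definition left_top :: "('a, 'b) ring_scheme \<Rightarrow> 'a \<Rightarrow> ('a, 'a set) module" where
  "left_top R e = quotient_module (left_proj R e) (jacobson_radical R #>\<^bsub>R\<^esub> e)"

definition right_soc :: "('a, 'b) ring_scheme \<Rightarrow> 'a \<Rightarrow> ('a, 'a) module" where
  "right_soc R e = (right_proj R e)\<lparr>carrier := socle R (right_proj R e)\<rparr>"

definition left_soc :: "('a, 'b) ring_scheme \<Rightarrow> 'a \<Rightarrow> ('a, 'a) module" where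
  "left_soc R e = (left_proj R e)\<lparr>carrier := socle R (left_proj R e)\<rparr>"

definition complete_primitive_idempotents ::
    "('a, 'b) ring_scheme \<Rightarrow> nat \<Rightarrow> (nat \<Rightarrow> 'a) \<Rightarrow> bool" where
  "complete_primitive_idempotents R m e \<longleftrightarrow>
     (\<forall>i \<in> {1..m}. primitive_idempotent R (e i)) \<and>
     (\<forall>i \<in> {1..m}. \<forall>j \<in> {1..m}. i \<noteq> j \<longrightarrow> e i \<otimes>\<^bsub>R\<^esub> e j = \<zero>\<^bsub>R\<^esub>) \<and>
     (\<Oplus>\<^bsub>R\<^esub>i \<in> {1..m}. e i) = \<one>\<^bsub>R\<^esub>"

text \<open>The first \<open>k\<close> of the \<open>m\<close> idempotents represent the isomorphism classes of the \<open>e\<^sub>i R\<close>.\<close>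

definition basic_ordering ::
    "('a, 'b) ring_scheme \<Rightarrow> nat \<Rightarrow> nat \<Rightarrow> (nat \<Rightarrow> 'a) \<Rightarrow> bool" where
  "basic_ordering R m k e \<longleftrightarrow> k \<le> m \<and>
     (\<forall>i \<in> {1..k}. \<forall>j \<in> {1..k}. i \<noteq> j \<longrightarrow>
        \<not> module_isomorphic R (right_proj R (e i)) (right_proj R (e j))) \<and>
     (\<forall>i \<in> {k<..m}. \<exists>j \<in> {1..k}.
        module_isomorphic R (right_proj R (e i)) (right_proj R (e j)))"

definition nakayama_permutation ::
    "('a, 'b) ring_scheme \<Rightarrow> nat \<Rightarrow> (nat \<Rightarrow> 'a) \<Rightarrow> (nat \<Rightarrow> nat) \<Rightarrow> bool" where
  "nakayama_permutation R k e \<pi> \<longleftrightarrow> \<pi> permutes {1..k} \<and>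
     (\<forall>i \<in> {1..k}.
        module_isomorphic R (right_soc R (e i)) (right_top R (e (\<pi> i))) \<and>
        module_isomorphic R (left_soc R (e (\<pi> i))) (left_top R (e i)))"

definition has_nakayama_permutation :: "('a, 'b) ring_scheme \<Rightarrow> bool" where
  "has_nakayama_permutation R \<longleftrightarrow>
     (\<exists>m k e \<pi>. complete_primitive_idempotents R m e \<and> basic_ordering R m k e \<and>
        nakayama_permutation R k e \<pi>)"

definition essential_socles :: "('a, 'b) ring_scheme \<Rightarrow> bool" where
  "essential_socles R \<longleftrightarrow>
     essential_submodule (socle R (right_regular R)) R (right_regular R) \<and>
     essential_submodule (socle R (left_regular R)) R (left_regular R)"

end

theory Submission
  imports Defs
begin

text \<open>
  Put \<open>f = 1 - e\<close> and suppose \<open>eRf = 0\<close>; then \<open>M = fRe\<close> is a square-zero ideal, so \<open>M \<subseteq> J(R)\<close>.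
  For a primitive idempotent \<open>p\<close>, the elements \<open>pep\<close> and \<open>pfp\<close> are orthogonal idempotents with
  sum \<open>p\<close>, so \<open>pf = 0\<close> or \<open>ep = 0\<close>. In the second case \<open>pRe \<subseteq> M \<subseteq> J(R)\<close>, hence \<open>e\<close> annihilates
  \<open>top(pR)\<close>. If \<open>e\<^sub>if = 0\<close>, then \<open>f\<close> annihilates \<open>e\<^sub>iR\<close>, and \<open>e\<close> cannot annihilate the nonzero
  module \<open>soc(e\<^sub>iR) \<cong> top(e\<^sub>\<pi>\<^sub>(\<^sub>i\<^sub>)R)\<close>, so \<open>e\<^sub>\<pi>\<^sub>(\<^sub>i\<^sub>)f = 0\<close>. Thus \<open>\<pi>\<close> preserves the set of indices with
  \<open>e\<^sub>if = 0\<close> and, by finiteness, its complement. If \<open>M \<noteq> 0\<close>, then \<open>e\<^sub>iR \<inter> M \<noteq> 0\<close> for some \<open>i \<le> k\<close>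
  with \<open>e\<^sub>if \<noteq> 0\<close>; this submodule meets \<open>soc(e\<^sub>iR)\<close>, which is annihilated by \<open>e\<close>, although \<open>e\<close> acts
  on \<open>M\<close> as the identity.
\<close>

context ring
begin

section \<open>Right submodules of \<open>R\<close> and of the modules \<open>pR\<close>\<close>

lemma right_regular_simps [simp]:
  "carrier (right_regular R) = carrier R" "\<zero>\<^bsub>right_regular R\<^esub> = \<zero>"
  "add (right_regular R) = add R"
  "a \<odot>\<^bsub>right_regular R\<^esub> x = x \<otimes> a"
  by (simp_all add: right_regular_def)

lemma right_proj_simps [simp]:
  "carrier (right_proj R p) = p <# carrier R" "\<zero>\<^bsub>right_proj R p\<^esub> = \<zero>"
  "add (right_proj R p) = add R"
  "a \<odot>\<^bsub>right_proj R p\<^esub> x = x \<otimes> a"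
  by (simp_all add: right_proj_def right_regular_def)

lemma right_soc_simps [simp]:
  "carrier (right_soc R p) = socle R (right_proj R p)"
  "a \<odot>\<^bsub>right_soc R p\<^esub> x = x \<otimes> a"
  by (simp_all add: right_soc_def)

lemma submodule_right_regular_iff:
  "submodule L R (right_regular R) \<longleftrightarrow>
     subgroup L (add_monoid R) \<and> (\<forall>x\<in>L. \<forall>a\<in>carrier R. x \<otimes> a \<in> L)"
  by (auto simp: submodule_def submodule_axioms_def subgroup_def m_inv_def)

text \<open>Closure under negation need not be checked separately: it is right multiplication by
  \<open>\<ominus> \<one>\<close>.\<close>

lemma right_submoduleI:
  assumes "L \<subseteq> carrier R" "\<zero> \<in> L" "\<And>x y. x \<in> L \<Longrightarrow> y \<in> L \<Longrightarrow> x \<oplus> y \<in> L"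
    "\<And>x a. x \<in> L \<Longrightarrow> a \<in> carrier R \<Longrightarrow> x \<otimes> a \<in> L"
  shows "submodule L R (right_regular R)"
proof -
  have "\<ominus> x \<in> L" if "x \<in> L" for x
    using assms(4)[OF that, of "\<ominus> \<one>"] that assms(1) by (auto simp: r_minus)
  then have "subgroup L (add_monoid R)"
    using assms by (intro add.subgroupI) (auto simp: a_inv_def)
  then show ?thesis using assms(4) by (simp add: submodule_right_regular_iff)
qed

lemma right_submoduleD:
  assumes "submodule L R (right_regular R)"
  shows "L \<subseteq> carrier R" "\<zero> \<in> L" "\<And>x y. x \<in> L \<Longrightarrow> y \<in> L \<Longrightarrow> x \<oplus> y \<in> L"
    "\<And>x. x \<in> L \<Longrightarrow> \<ominus> x \<in> L"
    "\<And>x a. x \<in> L \<Longrightarrow> a \<in> carrier R \<Longrightarrow> x \<otimes> a \<in> L"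
  using assms subgroup.m_closed[of L "add_monoid R"] subgroup.m_inv_closed[of L "add_monoid R"]
    subgroup.one_closed[of L "add_monoid R"] subgroup.subset[of L "add_monoid R"]
  unfolding submodule_right_regular_iff by (auto simp: a_inv_def)

lemma proj_subset: "p \<in> carrier R \<Longrightarrow> p <# carrier R \<subseteq> carrier R"
  by (auto simp: l_coset_def)

lemma mult_in_proj: "x \<in> carrier R \<Longrightarrow> p \<otimes> x \<in> p <# carrier R"
  by (auto simp: l_coset_def)

lemma right_mult_image_submodule:
  assumes "submodule L R (right_regular R)" "p \<in> carrier R"
  shows "submodule (p <# L) R (right_regular R)"
proof (rule right_submoduleI)
  note L = right_submoduleD[OF assms(1)]
  show "p <# L \<subseteq> carrier R" using L(1) assms(2) by (auto simp: l_coset_def)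
  show "\<zero> \<in> p <# L" using L(2) assms(2) unfolding l_coset_def by force
  show "x \<oplus> y \<in> p <# L" if "x \<in> p <# L" "y \<in> p <# L" for x y
  proof -
    obtain u v where "u \<in> L" "v \<in> L" "x = p \<otimes> u" "y = p \<otimes> v"
      using \<open>x \<in> p <# L\<close> \<open>y \<in> p <# L\<close> by (auto simp: l_coset_def)
    moreover from this have "x \<oplus> y = p \<otimes> (u \<oplus> v)"
      using L(1) assms(2) by (simp add: r_distr subset_iff)
    ultimately show ?thesis using L(3) unfolding l_coset_def by blast
  qed
  show "x \<otimes> a \<in> p <# L" if "x \<in> p <# L" "a \<in> carrier R" for x a
  proof -
    obtain u where "u \<in> L" "x = p \<otimes> u" using \<open>x \<in> p <# L\<close> by (auto simp: l_coset_def)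
    moreover from this have "x \<otimes> a = p \<otimes> (u \<otimes> a)"
      using L(1) assms(2) that by (simp add: m_assoc subset_iff)
    ultimately show ?thesis using L(5) that unfolding l_coset_def by blast
  qed
qed

lemma right_regular_submodule: "submodule (carrier R) R (right_regular R)"
  by (rule right_submoduleI) auto

lemma proj_subgroup: "p \<in> carrier R \<Longrightarrow> subgroup (p <# carrier R) (add_monoid R)"
  using right_mult_image_submodule[OF right_regular_submodule]
  by (simp add: submodule_right_regular_iff)

text \<open>The two monoids have different record types, so they cannot be equated directly.\<close>

lemma subgroup_right_proj:
  "subgroup L (add_monoid (right_proj R p)) \<longleftrightarrow>
    subgroup L ((add_monoid R)\<lparr>carrier := p <# carrier R\<rparr>)"
  by (simp add: subgroup_def m_inv_def)

lemma a_inv_right_proj: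
  assumes "p \<in> carrier R" "x \<in> p <# carrier R"
  shows "inv\<^bsub>add_monoid (right_proj R p)\<^esub> x = \<ominus> x"
proof -
  have "inv\<^bsub>add_monoid (right_proj R p)\<^esub> x =
      inv\<^bsub>(add_monoid R)\<lparr>carrier := p <# carrier R\<rparr>\<^esub> x"
    by (simp add: m_inv_def)
  then show ?thesis
    using add.m_inv_consistent[OF proj_subgroup[OF assms(1)] assms(2)] by (simp add: a_inv_def)
qed

lemma add_group_right_proj:
  assumes "p \<in> carrier R"
  shows "group (add_monoid (right_proj R p))"
proof -
  have "group ((add_monoid R)\<lparr>carrier := p <# carrier R\<rparr>)"
    by (rule subgroup.subgroup_is_group[OF proj_subgroup[OF assms] add.group_axioms])
  then show ?thesis
    by (simp add: group_def monoid_def group_axioms_def Units_def)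
qed

text \<open>Reduces submodules of \<open>pR\<close> to submodules of \<open>R\<close> as a right
  module, so that the closure rules for \<open>right_regular R\<close> serve for both
  modules.\<close>

lemma submodule_right_proj_iff:
  assumes "p \<in> carrier R"
  shows "submodule L R (right_proj R p) \<longleftrightarrow>
    submodule L R (right_regular R) \<and> L \<subseteq> p <# carrier R"
proof -
  have "subgroup L (add_monoid (right_proj R p)) \<longleftrightarrow>
      subgroup L (add_monoid R) \<and> L \<subseteq> p <# carrier R"
    unfolding subgroup_right_proj
    using add.incl_subgroup[OF proj_subgroup[OF assms]]
      add.subgroup_incl[OF _ proj_subgroup[OF assms]]
      subgroup.subset[of L "(add_monoid R)\<lparr>carrier := p <# carrier R\<rparr>"] by auto
  then show ?thesis
    unfolding submodule_right_regular_iff unfolding submodule_def submodule_axioms_def by auto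
qed

section \<open>Socles of \<open>R\<close> and of \<open>pR\<close>\<close>

text \<open>Left multiplication by \<open>p\<close> is a right linear map from \<open>S\<close> onto
  \<open>pS\<close>. The preimage \<open>K\<close> in \<open>S\<close> of a submodule
  \<open>L\<close> of \<open>pS\<close> is zero or all of \<open>S\<close>, and
  \<open>L = pK\<close>.\<close>

lemma simple_submodule_mult:
  assumes S: "simple_submodule S R (right_regular R)" and p: "p \<in> carrier R"
  shows "p <# S = {\<zero>} \<or> simple_submodule (p <# S) R (right_proj R p)"
proof -
  have sub: "submodule S R (right_regular R)" using S by (simp add: simple_submodule_def)
  note SD = right_submoduleD[OF sub]
  have "L = {\<zero>} \<or> L = p <# S" if L: "submodule L R (right_proj R p)" "L \<subseteq> p <# S" for L
  proof -
    note LD = right_submoduleD[OF L(1)[unfolded submodule_right_proj_iff[OF p], THEN conjunct1]]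
    define K where "K = {s \<in> S. p \<otimes> s \<in> L}"
    have "submodule K R (right_regular R)"
      using SD LD p by (intro right_submoduleI)
        (auto simp: K_def r_distr subset_iff m_assoc[symmetric])
    then have "K = {\<zero>} \<or> K = S" using S by (auto simp: simple_submodule_def K_def)
    moreover have "L = p <# K" using L(2) by (auto simp: K_def l_coset_def)
    ultimately show ?thesis using p by (auto simp: l_coset_def)
  qed
  moreover have "submodule (p <# S) R (right_proj R p)"
    unfolding submodule_right_proj_iff[OF p]
    using right_mult_image_submodule[OF sub p] SD(1) by (auto simp: l_coset_def)
  ultimately show ?thesis by (auto simp: simple_submodule_def)
qed

lemma zero_in_socle_right_proj: "\<zero> \<in> socle R (right_proj R p)"
  unfolding socle_def using generate.one[of "add_monoid (right_proj R p)"] by simp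

lemma simple_submodule_in_socle:
  "simple_submodule S R M \<Longrightarrow> x \<in> S \<Longrightarrow> x \<in> socle R M"
  unfolding socle_def by (rule generate.incl) blast

lemma socle_right_proj_add:
  "x \<in> socle R (right_proj R p) \<Longrightarrow> y \<in> socle R (right_proj R p) \<Longrightarrow>
    x \<oplus> y \<in> socle R (right_proj R p)"
  unfolding socle_def using generate.eng[of x "add_monoid (right_proj R p)" _ y] by simp

text \<open>A homomorphism maps the socle into the socle; here it is left multiplication by
  \<open>p\<close> from \<open>R\<close> to \<open>pR\<close>. Membership in
  \<open>carrier R\<close> is part of the claim because the induction step for sums uses
  distributivity.\<close>

lemma socle_right_regular_mult:
  assumes "x \<in> socle R (right_regular R)" and p: "p \<in> carrier R"
  shows "x \<in> carrier R \<and> p \<otimes> x \<in> socle R (right_proj R p)"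
proof -
  have simple: "h \<in> carrier R \<and> p \<otimes> h \<in> socle R (right_proj R p)"
    if S: "simple_submodule S R (right_regular R)" "h \<in> S" for S h
  proof -
    have ph: "p \<otimes> h \<in> p <# S" using S(2) by (auto simp: l_coset_def)
    have "p \<otimes> h \<in> socle R (right_proj R p)"
      using simple_submodule_mult[OF S(1) p]
    proof
      assume "p <# S = {\<zero>}"
      then show ?thesis using ph zero_in_socle_right_proj by simp
    next
      assume "simple_submodule (p <# S) R (right_proj R p)"
      then show ?thesis using ph by (rule simple_submodule_in_socle)
    qed
    then show ?thesis using S right_submoduleD(1)[of S] by (auto simp: simple_submodule_def)
  qed
  show ?thesis using assms(1)[unfolded socle_def]
  proof (induction rule: generate.induct)
    case one
    then show ?case using p zero_in_socle_right_proj by simp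
  next
    case (incl h)
    then show ?case using simple by blast
  next
    case (inv h)
    then obtain S where S: "simple_submodule S R (right_regular R)" "h \<in> S" by auto
    then have "\<ominus> h \<in> S" using right_submoduleD(4)[of S] by (auto simp: simple_submodule_def)
    moreover have "inv\<^bsub>add_monoid (right_regular R)\<^esub> h = \<ominus> h"
      by (simp add: a_inv_def m_inv_def)
    ultimately show ?case using simple[OF S(1)] by simp
  next
    case (eng x y)
    then show ?case using p socle_right_proj_add by (simp add: r_distr)
  qed
qed

lemma socle_right_proj:
  assumes "x \<in> socle R (right_proj R p)" and p: "p \<in> carrier R" and a: "a \<in> carrier R"
  shows "x \<in> p <# carrier R \<and> x \<otimes> a \<in> socle R (right_proj R p)"
proof -
  note pR = right_submoduleD[OF right_mult_image_submodule[OF right_regular_submodule p]]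
  have sub: "submodule S R (right_regular R) \<and> S \<subseteq> p <# carrier R"
    if "simple_submodule S R (right_proj R p)" for S
    using that by (simp add: simple_submodule_def submodule_right_proj_iff[OF p])
  have simple: "h \<in> p <# carrier R \<and> h \<otimes> a \<in> socle R (right_proj R p)"
    if S: "simple_submodule S R (right_proj R p)" "h \<in> S" for S h
  proof -
    have "h \<otimes> a \<in> S" using right_submoduleD(5)[of S h a] sub[OF S(1)] S(2) a by simp
    then show ?thesis using simple_submodule_in_socle[OF S(1)] sub[OF S(1)] S(2) by auto
  qed
  show ?thesis using assms(1)[unfolded socle_def]
  proof (induction rule: generate.induct)
    case one
    show ?case using a pR(2) zero_in_socle_right_proj by simp
  next
    case (incl h)
    then show ?case using simple by blast
  next
    case (inv h)
    then obtain S where S: "simple_submodule S R (right_proj R p)" "h \<in> S" by auto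
    then have "inv\<^bsub>add_monoid (right_proj R p)\<^esub> h = \<ominus> h"
      using a_inv_right_proj[OF p] sub[OF S(1)] by blast
    moreover have "\<ominus> h \<in> S" using right_submoduleD(4)[of S h] sub[OF S(1)] S(2) by simp
    ultimately show ?case using simple[OF S(1)] by simp
  next
    case (eng x y)
    then have "x \<in> carrier R" "y \<in> carrier R" using proj_subset[OF p] by blast+
    then show ?case using eng a pR(3) socle_right_proj_add by (simp add: l_distr)
  qed
qed

lemma idempotent_elem_fix:
  assumes "idempotent_elem R p" "x \<in> p <# carrier R"
  shows "p \<otimes> x = x"
  using assms by (auto simp: idempotent_elem_def l_coset_def m_assoc[symmetric])

text \<open>Essentiality passes from \<open>R\<close> to \<open>pR\<close>: a nonzero
  \<open>z\<close> in \<open>L\<close> and in the socle of \<open>R\<close> satisfies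
  \<open>p \<otimes> z = z\<close>, and left multiplication by \<open>p\<close> carries that socle
  into the socle of \<open>pR\<close>.\<close>

lemma essential_socle_right_proj:
  assumes ess: "essential_submodule (socle R (right_regular R)) R (right_regular R)"
    and p: "idempotent_elem R p"
    and L: "submodule L R (right_regular R)" "L \<subseteq> p <# carrier R" "L \<noteq> {\<zero>}"
  obtains z where "z \<in> L" "z \<in> socle R (right_proj R p)" "z \<noteq> \<zero>"
proof -
  have pR: "p \<in> carrier R" using p by (simp add: idempotent_elem_def)
  have "\<zero> \<in> socle R (right_regular R)"
    using ess right_submoduleD(2) unfolding essential_submodule_def by blast
  moreover have "socle R (right_regular R) \<inter> L \<noteq> {\<zero>}"
    using ess L unfolding essential_submodule_def by auto
  ultimately obtain z where z: "z \<in> L" "z \<in> socle R (right_regular R)" "z \<noteq> \<zero>"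
    using right_submoduleD(2)[OF L(1)] by blast
  have "p \<otimes> z = z" using idempotent_elem_fix[OF p] z L by blast
  then show thesis using that z socle_right_regular_mult[OF z(2) pR] by auto
qed

section \<open>The Jacobson radical and annihilators of tops and socles\<close>

lemma jacobson_radical_submodule: "submodule (jacobson_radical R) R (right_regular R)"
proof (rule right_submoduleI)
  have D: "maximal_submodule N R (right_regular R) \<Longrightarrow> submodule N R (right_regular R)" for N
    by (simp add: maximal_submodule_def)
  show "jacobson_radical R \<subseteq> carrier R" by (auto simp: jacobson_radical_def)
  show "\<zero> \<in> jacobson_radical R"
    using D right_submoduleD(2) by (auto simp: jacobson_radical_def)
  show "x \<oplus> y \<in> jacobson_radical R" if "x \<in> jacobson_radical R" "y \<in> jacobson_radical R" for x y
    using that D right_submoduleD(3) by (auto simp: jacobson_radical_def)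
  show "x \<otimes> a \<in> jacobson_radical R" if "x \<in> jacobson_radical R" "a \<in> carrier R" for x a
    using that D right_submoduleD(5) by (auto simp: jacobson_radical_def)
qed

text \<open>If a maximal \<open>N\<close> did not contain \<open>M\<close>, then
  \<open>M + N = R\<close> and \<open>1 = m + n\<close>. Multiplying by \<open>m\<close> on the
  right gives \<open>m = n m\<close>, as \<open>m m = 0\<close>. So \<open>m\<close>, and with it
  \<open>1\<close>, would lie in \<open>N\<close>.\<close>

lemma square_zero_submodule_le_jacobson_radical:
  assumes M: "submodule M R (right_regular R)"
    and sq: "\<And>x y. x \<in> M \<Longrightarrow> y \<in> M \<Longrightarrow> x \<otimes> y = \<zero>"
  shows "M \<subseteq> jacobson_radical R"
proof
  note MD = right_submoduleD[OF M]
  fix x assume x: "x \<in> M"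
  have "x \<in> N" if N: "maximal_submodule N R (right_regular R)" for N
  proof (rule ccontr)
    assume "x \<notin> N"
    have subN: "submodule N R (right_regular R)" using N by (simp add: maximal_submodule_def)
    note ND = right_submoduleD[OF subN]
    define K where "K = {m \<oplus> n | m n. m \<in> M \<and> n \<in> N}"
    have "submodule K R (right_regular R)"
    proof (rule right_submoduleI)
      show "K \<subseteq> carrier R" using MD ND by (auto simp: K_def)
      show "\<zero> \<in> K" using MD(2) ND(2) unfolding K_def by force
      show "u \<oplus> v \<in> K" if uv: "u \<in> K" "v \<in> K" for u v
      proof -
        obtain m n m' n' where *: "m \<in> M" "n \<in> N" "m' \<in> M" "n' \<in> N"
          "u = m \<oplus> n" "v = m' \<oplus> n'" using uv by (auto simp: K_def)
        moreover from * have "u \<oplus> v = (m \<oplus> m') \<oplus> (n \<oplus> n')"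
          using MD(1) ND(1) by (simp add: subset_iff a_ac)
        ultimately show ?thesis using MD(3) ND(3) unfolding K_def by blast
      qed
      show "u \<otimes> a \<in> K" if ua: "u \<in> K" "a \<in> carrier R" for u a
      proof -
        obtain m n where *: "m \<in> M" "n \<in> N" "u = m \<oplus> n" using ua by (auto simp: K_def)
        moreover from * have "u \<otimes> a = m \<otimes> a \<oplus> n \<otimes> a"
          using MD(1) ND(1) ua by (simp add: subset_iff l_distr)
        ultimately show ?thesis using MD(5) ND(5) ua unfolding K_def by blast
      qed
    qed
    moreover have "N \<subseteq> K"
    proof
      fix n assume "n \<in> N"
      then show "n \<in> K" using MD(2) ND(1) unfolding K_def by force
    qed
    moreover have "x \<in> K" using x ND(2) MD(1) unfolding K_def by force
    ultimately have "K = carrier R"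
      using N \<open>x \<notin> N\<close> by (auto simp: maximal_submodule_def)
    then obtain m n where mn: "m \<in> M" "n \<in> N" "\<one> = m \<oplus> n"
      using one_closed unfolding K_def by blast
    then have c: "m \<in> carrier R" "n \<in> carrier R" using MD(1) ND(1) by auto
    have "m = (m \<oplus> n) \<otimes> m" using c mn(3)[symmetric] by simp
    then have "m = n \<otimes> m" using c sq[OF mn(1) mn(1)] by (simp add: l_distr)
    then have "m \<in> N" using ND(5)[OF mn(2) c(1)] by simp
    then have "\<one> \<in> N" using ND(3)[OF _ mn(2)] mn(3) by simp
    then have "carrier R \<subseteq> N" using ND(5)[of \<one>] by auto
    then show False using N ND(1) by (auto simp: maximal_submodule_def)
  qed
  then show "x \<in> jacobson_radical R" using x MD(1) by (auto simp: jacobson_radical_def)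
qed

lemma right_top_annihilated:
  assumes p: "idempotent_elem R p" and a: "a \<in> carrier R"
    and ann: "\<And>x. x \<in> p <# carrier R \<Longrightarrow> x \<otimes> a \<in> jacobson_radical R"
    and X: "X \<in> carrier (right_top R p)"
  shows "a \<odot>\<^bsub>right_top R p\<^esub> X = p <# jacobson_radical R"
proof -
  let ?P = "right_proj R p" and ?N = "p <# jacobson_radical R"
  have pR: "p \<in> carrier R" using p by (simp add: idempotent_elem_def)
  interpret P: group "add_monoid ?P" by (rule add_group_right_proj[OF pR])
  have JR: "jacobson_radical R \<subseteq> carrier R" by (auto simp: jacobson_radical_def)
  have "submodule ?N R ?P"
    unfolding submodule_right_proj_iff[OF pR]
    using right_mult_image_submodule[OF jacobson_radical_submodule pR] JR
    by (auto simp: l_coset_def)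
  then have N: "subgroup ?N (add_monoid ?P)" by (simp add: submodule_def)
  have X': "X \<in> rcosets\<^bsub>add_monoid ?P\<^esub> ?N"
    using X by (simp add: right_top_def quotient_module_def A_RCOSETS_def)
  have Xne: "X \<noteq> {}" by (rule subgroup.rcosets_non_empty[OF N X'])
  have Xsub: "X \<subseteq> p <# carrier R" using P.rcosets_part_G[OF N] X' by auto
  have "?N +>\<^bsub>?P\<^esub> (x \<otimes> a) = ?N" if "x \<in> X" for x
  proof -
    have x: "x \<in> p <# carrier R" using that Xsub by blast
    then have xR: "x \<in> carrier R" using proj_subset[OF pR] by blast
    \<comment> \<open>The assumption places \<open>x \<otimes> a\<close> in \<open>J(R)\<close>
      only, while the zero of the top is \<open>pJ(R)\<close>; the factor \<open>p\<close> is
      recovered from \<open>p \<otimes> x = x\<close>.\<close>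
    have "x \<otimes> a = p \<otimes> (x \<otimes> a)"
      using idempotent_elem_fix[OF p x] pR xR a by (simp add: m_assoc[symmetric])
    then have "x \<otimes> a \<in> ?N" using ann[OF x] unfolding l_coset_def by blast
    then show ?thesis
      unfolding a_r_coset_def using P.coset_join2[OF _ N] subgroup.subset[OF N] by blast
  qed
  then show ?thesis using Xne by (auto simp: right_top_def quotient_module_def)
qed

lemma right_soc_annihilated:
  assumes p: "idempotent_elem R p" and q: "q \<in> carrier R" and a: "a \<in> carrier R"
    and iso: "module_isomorphic R (right_soc R q) (right_top R p)"
    and ann: "\<And>x. x \<in> p <# carrier R \<Longrightarrow> x \<otimes> a \<in> jacobson_radical R"
    and s: "s \<in> socle R (right_proj R q)"
  shows "s \<otimes> a = \<zero>"
proof -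
  obtain h where h: "h \<in> Group.iso (add_monoid (right_soc R q)) (add_monoid (right_top R p))"
    and lin: "\<And>b x. b \<in> carrier R \<Longrightarrow> x \<in> socle R (right_proj R q) \<Longrightarrow>
      h (x \<otimes> b) = b \<odot>\<^bsub>right_top R p\<^esub> h x"
    using iso unfolding module_isomorphic_def by auto
  have bij: "bij_betw h (socle R (right_proj R q)) (carrier (right_top R p))"
    using h by (simp add: iso_def)
  have const: "h (x \<otimes> a) = p <# jacobson_radical R" if "x \<in> socle R (right_proj R q)" for x
    using lin[OF a that] right_top_annihilated[OF p a ann] bij that by (auto simp: bij_betw_def)
  \<comment> \<open>Comparing with \<open>\<zero> \<otimes> a\<close>, which \<open>h\<close> also
    sends to the zero coset, lets injectivity finish without computing
    \<open>h \<zero>\<close>.\<close>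
  have "h (s \<otimes> a) = h (\<zero> \<otimes> a)"
    using const[OF s] const[OF zero_in_socle_right_proj] by simp
  moreover have "s \<otimes> a \<in> socle R (right_proj R q)" "\<zero> \<otimes> a \<in> socle R (right_proj R q)"
    using socle_right_proj[OF _ q a] s zero_in_socle_right_proj by auto
  ultimately show ?thesis using bij a by (metis bij_betw_imp_inj_on inj_onD l_null)
qed

section \<open>Detecting nonzero elements by primitive idempotents\<close>

text \<open>For an isomorphism \<open>h\<close> from \<open>qR\<close> to \<open>pR\<close>, the
  witness is \<open>r = h q\<close>: linearity gives \<open>h (q m) = h q m = p (h q m)\<close>, and
  this is nonzero by injectivity. It serves to replace an arbitrary idempotent of the complete set
  by one of the chosen representatives.\<close>

lemma right_proj_iso_transfer:
  assumes iso: "module_isomorphic R (right_proj R q) (right_proj R p)"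
    and q: "q \<in> carrier R" and p: "idempotent_elem R p"
    and m: "m \<in> carrier R" "q \<otimes> m \<noteq> \<zero>"
  obtains r where "r \<in> carrier R" "p \<otimes> (r \<otimes> m) \<noteq> \<zero>"
proof -
  have pR: "p \<in> carrier R" using p by (simp add: idempotent_elem_def)
  obtain h where h: "h \<in> Group.iso (add_monoid (right_proj R q)) (add_monoid (right_proj R p))"
    and lin: "\<And>b x. b \<in> carrier R \<Longrightarrow> x \<in> q <# carrier R \<Longrightarrow> h (x \<otimes> b) = h x \<otimes> b"
    using iso unfolding module_isomorphic_def by auto
  have bij: "bij_betw h (q <# carrier R) (p <# carrier R)" using h by (simp add: iso_def)
  have mem: "q \<in> q <# carrier R" "q \<otimes> m \<in> q <# carrier R" "\<zero> \<in> q <# carrier R"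
    using mult_in_proj[of \<one> q] mult_in_proj[OF m(1), of q] mult_in_proj[of \<zero> q] q by simp_all
  have hq: "h q \<in> p <# carrier R" "h \<zero> \<in> p <# carrier R"
    using bij mem by (auto simp: bij_betw_def)
  then have hc: "h q \<in> carrier R" "h \<zero> \<in> carrier R" using proj_subset[OF pR] by auto
  have "h (\<zero> \<otimes> \<zero>) = h \<zero> \<otimes> \<zero>" using lin[OF zero_closed mem(3)] .
  then have "h \<zero> = \<zero>" using hc by simp
  then have "h (q \<otimes> m) \<noteq> \<zero>"
    using bij mem m(2) by (metis bij_betw_imp_inj_on inj_onD)
  moreover have "h (q \<otimes> m) = p \<otimes> (h q \<otimes> m)"
    using lin[OF m(1) mem(1)] idempotent_elem_fix[OF p hq(1)] pR hc m(1)
    by (simp add: m_assoc[symmetric])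
  ultimately show thesis using that hc(1) by auto
qed

lemma complete_idempotents_detect:
  assumes "complete_primitive_idempotents R n e" "x \<in> carrier R" "x \<noteq> \<zero>"
  obtains j where "j \<in> {1..n}" "e j \<otimes> x \<noteq> \<zero>"
proof -
  have e: "e \<in> {1..n} \<rightarrow> carrier R"
    using assms(1) by (auto simp: complete_primitive_idempotents_def primitive_idempotent_def
        idempotent_elem_def)
  have "x = (\<Oplus>i\<in>{1..n}. e i) \<otimes> x"
    using assms by (simp add: complete_primitive_idempotents_def)
  also have "\<dots> = (\<Oplus>i\<in>{1..n}. e i \<otimes> x)"
    using e assms(2) by (simp add: finsum_ldistr)
  finally have "\<exists>j\<in>{1..n}. e j \<otimes> x \<noteq> \<zero>"
    using add.finprod_one_eqI[of "{1..n}" "\<lambda>i. e i \<otimes> x"] assms(3)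
    by (metis finsum_def)
  then show thesis using that by blast
qed

text \<open>From \<open>eRf = 0\<close> follow \<open>epe = ep\<close> and \<open>fpf = pf\<close>,
  which make \<open>pep\<close> and \<open>pfp\<close> idempotent. One of them vanishes by
  primitivity: \<open>pep = 0\<close> gives \<open>0 = epep = ep\<close>, and \<open>pfp = 0\<close>
  gives \<open>0 = pfpf = pf\<close>.\<close>

lemma primitive_idempotent_corner:
  assumes prim: "primitive_idempotent R p"
    and c: "e \<in> carrier R" "f \<in> carrier R" and sum: "e \<oplus> f = \<one>"
    and id: "e \<otimes> e = e" "f \<otimes> f = f" "e \<otimes> f = \<zero>" "f \<otimes> e = \<zero>"
    and tri: "\<And>r. r \<in> carrier R \<Longrightarrow> e \<otimes> (r \<otimes> f) = \<zero>"
  shows "p \<otimes> f = \<zero> \<or> e \<otimes> p = \<zero>"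
proof -
  have p: "p \<in> carrier R" "p \<otimes> p = p"
    using prim by (auto simp: primitive_idempotent_def idempotent_elem_def)
  have pa: "p \<otimes> (p \<otimes> x) = p \<otimes> x" if "x \<in> carrier R" for x
    using p that by (simp add: m_assoc[symmetric])
  have split: "x = e \<otimes> x \<oplus> f \<otimes> x" "x = x \<otimes> e \<oplus> x \<otimes> f" if "x \<in> carrier R" for x
    using that c sum by (simp_all flip: l_distr r_distr)
  have "e \<otimes> p = (e \<otimes> p) \<otimes> e \<oplus> (e \<otimes> p) \<otimes> f" using split(2)[of "e \<otimes> p"] c p by simp
  then have epe: "e \<otimes> (p \<otimes> e) = e \<otimes> p" using c p tri[of p] by (simp add: m_assoc)
  have "p \<otimes> f = e \<otimes> (p \<otimes> f) \<oplus> f \<otimes> (p \<otimes> f)" using split(1)[of "p \<otimes> f"] c p by simp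
  then have fpf: "f \<otimes> (p \<otimes> f) = p \<otimes> f" using c p tri[of p] by simp
  have epep: "e \<otimes> (p \<otimes> (e \<otimes> x)) = e \<otimes> (p \<otimes> x)" if "x \<in> carrier R" for x
    using arg_cong[OF epe, of "\<lambda>y. y \<otimes> x"] c p that by (simp add: m_assoc)
  have fpfx: "f \<otimes> (p \<otimes> (f \<otimes> x)) = p \<otimes> (f \<otimes> x)" if "x \<in> carrier R" for x
    using arg_cong[OF fpf, of "\<lambda>y. y \<otimes> x"] c p that by (simp add: m_assoc)
  have epf: "e \<otimes> (p \<otimes> (f \<otimes> x)) = \<zero>" if "x \<in> carrier R" for x
    using arg_cong[OF tri[OF p(1)], of "\<lambda>y. y \<otimes> x"] c p that by (simp add: m_assoc)
  have fe: "f \<otimes> (e \<otimes> x) = \<zero>" if "x \<in> carrier R" for x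
    using id(4) c that by (simp add: m_assoc[symmetric])
  let ?g = "p \<otimes> (e \<otimes> p)" and ?h = "p \<otimes> (f \<otimes> p)"
  have "idempotent_elem R ?g" "idempotent_elem R ?h" "?g \<otimes> ?h = \<zero>"
    using c p by (simp_all add: idempotent_elem_def m_assoc pa epep fpfx epf)
  moreover have psum: "p = ?g \<oplus> ?h"
  proof -
    have "?g \<oplus> ?h = p \<otimes> (e \<otimes> p \<oplus> f \<otimes> p)" using c p by (simp add: r_distr)
    then show ?thesis using split(1)[OF p(1)] p by simp
  qed
  \<comment> \<open>This product is not an instance of \<open>tri\<close>. It is cancelled from
    \<open>?g = p ?g = ?g ?g + ?h ?g\<close>, where \<open>?g ?g = ?g\<close>.\<close>
  moreover have "?h \<otimes> ?g = \<zero>"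
  proof -
    have "?g = p \<otimes> ?g" using c p by (simp add: pa)
    also have "\<dots> = (?g \<oplus> ?h) \<otimes> ?g" using psum by simp
    also have "\<dots> = ?g \<otimes> ?g \<oplus> ?h \<otimes> ?g" using c p by (intro l_distr) auto
    also have "?g \<otimes> ?g = ?g" using \<open>idempotent_elem R ?g\<close> by (simp add: idempotent_elem_def)
    finally show ?thesis using c p by simp
  qed
  ultimately have "?g = \<zero> \<or> ?h = \<zero>" using prim by (auto simp: primitive_idempotent_def)
  then show ?thesis
  proof
    assume "?g = \<zero>"
    then have "e \<otimes> ?g = \<zero>" using c by simp
    then show ?thesis using epep[OF p(1)] p by simp
  next
    assume "?h = \<zero>"
    then have "?h \<otimes> f = \<zero>" using c by simp
    then show ?thesis using fpf c p by (simp add: m_assoc pa)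
  qed
qed

section \<open>Triangular decompositions and the Nakayama permutation\<close>

text \<open>The assumptions on the pair \<open>e\<close>, \<open>f\<close> other than
  \<open>tri\<close> are symmetric, so exchanging the two elements yields the converse implication
  as well.\<close>

lemma triangular_imp_diagonal:
  assumes nak: "has_nakayama_permutation R"
    and ess: "essential_submodule (socle R (right_regular R)) R (right_regular R)"
    and c: "e \<in> carrier R" "f \<in> carrier R" and sum: "e \<oplus> f = \<one>"
    and id: "e \<otimes> e = e" "f \<otimes> f = f" "e \<otimes> f = \<zero>" "f \<otimes> e = \<zero>"
    and tri: "\<And>r. r \<in> carrier R \<Longrightarrow> e \<otimes> (r \<otimes> f) = \<zero>"
    and r: "r \<in> carrier R"
  shows "f \<otimes> (r \<otimes> e) = \<zero>"
proof (rule ccontr)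
  assume nz: "f \<otimes> (r \<otimes> e) \<noteq> \<zero>"
  obtain n k \<epsilon> \<pi> where comp: "complete_primitive_idempotents R n \<epsilon>"
    and basic: "basic_ordering R n k \<epsilon>" and perm: "\<pi> permutes {1..k}"
    and soc: "\<And>i. i \<in> {1..k} \<Longrightarrow>
      module_isomorphic R (right_soc R (\<epsilon> i)) (right_top R (\<epsilon> (\<pi> i)))"
    using nak by (auto simp: has_nakayama_permutation_def nakayama_permutation_def)
  have kn: "k \<le> n" using basic by (simp add: basic_ordering_def)
  have prim: "primitive_idempotent R (\<epsilon> i)" if "i \<in> {1..n}" for i
    using comp that by (simp add: complete_primitive_idempotents_def)
  have idem: "idempotent_elem R (\<epsilon> i)" "\<epsilon> i \<in> carrier R" "\<epsilon> i \<noteq> \<zero>" if "i \<in> {1..n}" for i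
    using prim[OF that] by (auto simp: primitive_idempotent_def idempotent_elem_def)
  have dich: "\<epsilon> i \<otimes> f = \<zero> \<or> e \<otimes> \<epsilon> i = \<zero>" if "i \<in> {1..n}" for i
    by (rule primitive_idempotent_corner[OF prim[OF that] c sum id tri])
  have split: "x = e \<otimes> x \<oplus> f \<otimes> x" "x = x \<otimes> e \<oplus> x \<otimes> f" if "x \<in> carrier R" for x
    using that c sum by (simp_all flip: l_distr r_distr)

  \<comment> \<open>This is \<open>fRe\<close>, described by equations so that membership can be
    checked by calculation.\<close>
  define M where "M = {x \<in> carrier R. e \<otimes> x = \<zero> \<and> x \<otimes> e = x}"
  have M_fix: "f \<otimes> x = x" if "x \<in> M" for x
    using split(1)[of x] that c by (simp add: M_def)
  \<comment> \<open>\<open>M\<close> is a two-sided ideal because \<open>eRf = 0\<close>: for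
    \<open>x\<close> in \<open>M\<close>, one has \<open>x a f = x (e a f) = 0\<close> and
    \<open>e a x = (e a f) x = 0\<close>.\<close>
  have M_right: "x \<otimes> a \<in> M" if "x \<in> M" "a \<in> carrier R" for x a
  proof -
    have x: "x \<in> carrier R" "e \<otimes> x = \<zero>" "x \<otimes> e = x" using that by (auto simp: M_def)
    have "x \<otimes> a \<otimes> f = x \<otimes> (e \<otimes> (a \<otimes> f))"
      using x c that(2) by (simp flip: m_assoc)
    then have "x \<otimes> a \<otimes> f = \<zero>" using tri[OF that(2)] x by simp
    then have "x \<otimes> a = x \<otimes> a \<otimes> e" using split(2)[of "x \<otimes> a"] x c that(2) by simp
    moreover have "e \<otimes> (x \<otimes> a) = \<zero>" using x c that(2) by (simp flip: m_assoc)
    ultimately show ?thesis using x that(2) by (simp add: M_def)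
  qed
  have M_left: "a \<otimes> x \<in> M" if "x \<in> M" "a \<in> carrier R" for x a
  proof -
    have x: "x \<in> carrier R" "x \<otimes> e = x" using that by (auto simp: M_def)
    have "e \<otimes> (a \<otimes> x) = e \<otimes> (a \<otimes> f) \<otimes> x"
      using M_fix[OF that(1)] x c that(2) by (simp add: m_assoc)
    then show ?thesis using tri[OF that(2)] x c that(2) by (simp add: M_def m_assoc)
  qed
  have M_sub: "submodule M R (right_regular R)"
    using M_right by (intro right_submoduleI) (auto simp: M_def c l_distr r_distr)
  have M_sq: "x \<otimes> y = \<zero>" if "x \<in> M" "y \<in> M" for x y
  proof -
    have xy: "x \<in> carrier R" "x \<otimes> e = x" "y \<in> carrier R" "e \<otimes> y = \<zero>"
      using that by (simp_all add: M_def)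
    then have "x \<otimes> y = x \<otimes> (e \<otimes> y)" using m_assoc[OF xy(1) c(1) xy(3)] by simp
    then show ?thesis using xy by simp
  qed
  have M_J: "M \<subseteq> jacobson_radical R"
    by (rule square_zero_submodule_le_jacobson_radical[OF M_sub M_sq])

  \<comment> \<open>When \<open>e\<close> kills \<open>\<epsilon> (\<pi> i)\<close> from the left,
    every element of \<open>\<epsilon> (\<pi> i) R e\<close> is killed by \<open>e\<close> on the
    left and fixed by \<open>e\<close> on the right. It therefore lies in \<open>M\<close>, hence in
    \<open>J(R)\<close>, so \<open>e\<close> annihilates the top and the socle isomorphic to
    it.\<close>
  have soc_e: "s \<otimes> e = \<zero>"
    if i: "i \<in> {1..k}" and ann: "e \<otimes> \<epsilon> (\<pi> i) = \<zero>" and s: "s \<in> socle R (right_proj R (\<epsilon> i))"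
    for i s
  proof -
    have i': "i \<in> {1..n}" "\<pi> i \<in> {1..n}" using i permutes_in_image[OF perm, of i] kn by auto
    have "x \<otimes> e \<in> jacobson_radical R" if x: "x \<in> \<epsilon> (\<pi> i) <# carrier R" for x
    proof -
      obtain b where b: "b \<in> carrier R" "x = \<epsilon> (\<pi> i) \<otimes> b" using x by (auto simp: l_coset_def)
      have "e \<otimes> (x \<otimes> e) = e \<otimes> \<epsilon> (\<pi> i) \<otimes> (b \<otimes> e)"
        using b c idem(2)[OF i'(2)] by (simp add: m_assoc)
      then have "x \<otimes> e \<in> M"
        using b c idem(2)[OF i'(2)] ann by (simp add: M_def m_assoc id)
      then show ?thesis using M_J by blast
    qed
    then show ?thesis
      by (rule right_soc_annihilated[OF idem(1)[OF i'(2)] idem(2)[OF i'(1)] c(1) soc[OF i] _ s])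
  qed

  \<comment> \<open>By \<open>dich\<close>, every index in \<open>{1..k}\<close> outside
    \<open>I\<close> satisfies \<open>e \<otimes> \<epsilon> i = \<zero>\<close>, the hypothesis
    under which \<open>soc_e\<close> applies.\<close>
  define I where "I = {i \<in> {1..k}. \<epsilon> i \<otimes> f = \<zero>}"
  have "\<pi> ` I \<subseteq> I"
  proof
    fix j assume "j \<in> \<pi> ` I"
    then obtain i where i: "i \<in> {1..k}" "\<epsilon> i \<otimes> f = \<zero>" "j = \<pi> i" by (auto simp: I_def)
    then have j: "j \<in> {1..k}" using permutes_in_image[OF perm, of i] by simp
    have i': "i \<in> {1..n}" using i kn by auto
    note \<epsilon>i = idem[OF i']
    have "\<epsilon> j \<otimes> f = \<zero>"
    proof (rule ccontr)
      assume "\<epsilon> j \<otimes> f \<noteq> \<zero>"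
      then have ann: "e \<otimes> \<epsilon> (\<pi> i) = \<zero>" using dich[of j] j kn i(3) by auto
      have "\<epsilon> i \<in> \<epsilon> i <# carrier R" using mult_in_proj[of \<one> "\<epsilon> i"] \<epsilon>i(2) by simp
      then have "\<epsilon> i <# carrier R \<noteq> {\<zero>}" using \<epsilon>i(3) by auto
      then obtain z where z: "z \<in> \<epsilon> i <# carrier R" "z \<in> socle R (right_proj R (\<epsilon> i))" "z \<noteq> \<zero>"
        using essential_socle_right_proj[OF ess \<epsilon>i(1)
            right_mult_image_submodule[OF right_regular_submodule \<epsilon>i(2)]] by blast
      then obtain b where b: "b \<in> carrier R" "z = \<epsilon> i \<otimes> b" by (auto simp: l_coset_def)
      \<comment> \<open>Since \<open>e b f = 0\<close>, the factor \<open>f\<close> can be moved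
        next to \<open>\<epsilon> i\<close>, where
        \<open>\<epsilon> i \<otimes> f = \<zero>\<close>. Thus \<open>z\<close> is annihilated by
        both \<open>f\<close> and \<open>e\<close>.\<close>
      have "b \<otimes> f = f \<otimes> (b \<otimes> f)"
        using split(1)[of "b \<otimes> f"] tri[OF b(1)] b(1) c by simp
      then have "z \<otimes> f = \<epsilon> i \<otimes> f \<otimes> (b \<otimes> f)"
        using b c \<epsilon>i(2) by (simp add: m_assoc)
      then have "z \<otimes> f = \<zero>" using i(2) b c by simp
      moreover have "z \<otimes> e = \<zero>" by (rule soc_e[OF i(1) ann z(2)])
      ultimately have "z = \<zero>" using split(2)[of z] b \<epsilon>i(2) by simp
      then show False using z(3) by simp
    qed
    then show "j \<in> I" using j by (simp add: I_def)
  qed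
  moreover have "finite I" by (simp add: I_def)
  \<comment> \<open>An injective map of a finite set into itself is onto. Equality, not just
    inclusion, is what keeps \<open>\<pi>\<close> from sending an index outside \<open>I\<close>
    into \<open>I\<close>.\<close>
  ultimately have piI: "\<pi> ` I = I"
    by (intro endo_inj_surj) (auto intro: inj_on_subset[OF permutes_inj[OF perm]])

  have m0: "f \<otimes> (r \<otimes> e) \<in> M"
  proof -
    have "e \<otimes> (f \<otimes> (r \<otimes> e)) = e \<otimes> f \<otimes> (r \<otimes> e)" using c r by (simp add: m_assoc)
    then show ?thesis using c r id by (simp add: M_def m_assoc)
  qed
  then have m0R: "f \<otimes> (r \<otimes> e) \<in> carrier R" by (simp add: M_def)
  obtain j where j: "j \<in> {1..n}" "\<epsilon> j \<otimes> (f \<otimes> (r \<otimes> e)) \<noteq> \<zero>"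
    using complete_idempotents_detect[OF comp m0R nz] .
  \<comment> \<open>The index \<open>j\<close> may exceed \<open>k\<close>, outside the range of the
    permutation. Passing to an isomorphic representative multiplies the element on the left, and
    \<open>M\<close> is a left ideal, so the new \<open>m\<close> is still in
    \<open>M\<close>.\<close>
  obtain i m where i: "i \<in> {1..k}" and m: "m \<in> M" "\<epsilon> i \<otimes> m \<noteq> \<zero>"
  proof (cases "j \<le> k")
    case True
    then show thesis using that[of j] j m0 by simp
  next
    case False
    then have "j \<in> {k<..n}" using j(1) by simp
    then obtain i where i: "i \<in> {1..k}"
      and iso: "module_isomorphic R (right_proj R (\<epsilon> j)) (right_proj R (\<epsilon> i))"
      using basic unfolding basic_ordering_def by blast
    have "i \<in> {1..n}" using i kn by auto
    then show thesis
      using right_proj_iso_transfer[OF iso idem(2)[OF j(1)] idem(1) m0R j(2)] that[OF i] M_left[OF m0]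
      by metis
  qed
  have i': "i \<in> {1..n}" using i kn by auto
  note \<epsilon>i = idem[OF i']
  have mR: "m \<in> carrier R" using m by (simp add: M_def)
  have "\<epsilon> i \<otimes> f \<noteq> \<zero>"
  proof
    assume "\<epsilon> i \<otimes> f = \<zero>"
    then have "\<epsilon> i \<otimes> f \<otimes> m = \<zero>" using mR by simp
    then show False using m M_fix[OF m(1)] \<epsilon>i(2) mR c by (simp add: m_assoc)
  qed
  then have "i \<notin> I" by (simp add: I_def)
  then have "\<pi> i \<notin> I" using piI permutes_inj[OF perm] by (metis imageE injD)
  then have ann: "e \<otimes> \<epsilon> (\<pi> i) = \<zero>"
    using dich[of "\<pi> i"] permutes_in_image[OF perm, of i] i kn by (auto simp: I_def)
  \<comment> \<open>This submodule lies in both \<open>\<epsilon> i R\<close> and \<open>M\<close>.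
    A nonzero socle element \<open>z\<close> in it satisfies \<open>z e = z\<close> as a member of
    \<open>M\<close>, and \<open>z e = 0\<close> by \<open>soc_e\<close>.\<close>
  let ?L = "\<epsilon> i <# M"
  have "?L \<subseteq> \<epsilon> i <# carrier R" by (auto simp: l_coset_def M_def)
  moreover have "?L \<noteq> {\<zero>}" using m unfolding l_coset_def by blast
  ultimately obtain z where z: "z \<in> ?L" "z \<in> socle R (right_proj R (\<epsilon> i))" "z \<noteq> \<zero>"
    using essential_socle_right_proj[OF ess \<epsilon>i(1) right_mult_image_submodule[OF M_sub \<epsilon>i(2)]]
    by blast
  have "z \<in> M" using z(1) M_left \<epsilon>i(2) by (auto simp: l_coset_def)
  then show False using soc_e[OF i ann z(2)] z(3) by (simp add: M_def)
qed

text \<open>Connects the set products of the theorem with the elementwise form of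
  \<open>tri\<close>; that \<open>\<zero>\<close> belongs to the product is witnessed by
  \<open>r = \<zero>\<close>.\<close>

lemma corner_eq_zero_iff:
  assumes "a \<in> carrier R" "b \<in> carrier R"
  shows "(a <# carrier R) #> b = {\<zero>} \<longleftrightarrow> (\<forall>r\<in>carrier R. a \<otimes> (r \<otimes> b) = \<zero>)"
  using assms zero_closed by (auto simp: l_coset_def r_coset_def m_assoc)

end

theorem proposition18:
  fixes R :: "('a, 'b) ring_scheme" (structure) and e :: 'a
  assumes "ring R" and "semiperfect R"
    and "has_nakayama_permutation R"
    and "essential_socles R"
    and "idempotent_elem R e"
  shows "(e <# carrier R) #> (\<one> \<ominus> e) = {\<zero>} \<longleftrightarrow>
         ((\<one> \<ominus> e) <# carrier R) #> e = {\<zero>}"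
proof -
  interpret ring R by fact
  let ?f = "\<one> \<ominus> e"
  have e: "e \<in> carrier R" "e \<otimes> e = e" using assms(5) by (auto simp: idempotent_elem_def)
  have f: "?f \<in> carrier R" using e by simp
  have ef: "e \<otimes> ?f = \<zero>" "?f \<otimes> e = \<zero>"
    using e by (simp_all add: minus_eq r_distr l_distr r_minus l_minus r_neg)
  have sum': "?f \<oplus> e = \<one>" using e by (simp add: minus_eq a_assoc l_neg)
  then have sum: "e \<oplus> ?f = \<one>" using e f by (simp add: a_comm)
  \<comment> \<open>Obtained by expanding \<open>(e + f) f\<close>, which is \<open>f\<close>
    because the sum is \<open>1\<close>, and using \<open>e f = 0\<close>.\<close>
  have ff: "?f \<otimes> ?f = ?f"
    using l_distr[OF e(1) f f] ef f unfolding sum by simp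
  have ess: "essential_submodule (socle R (right_regular R)) R (right_regular R)"
    using assms(4) by (simp add: essential_socles_def)
  \<comment> \<open>The two directions are the same lemma, applied once to \<open>e\<close>,
    \<open>1 - e\<close> and once to \<open>1 - e\<close>, \<open>e\<close>.\<close>
  show ?thesis
    unfolding corner_eq_zero_iff[OF e(1) f] corner_eq_zero_iff[OF f e(1)]
    using triangular_imp_diagonal[OF assms(3) ess e(1) f sum e(2) ff ef]
      triangular_imp_diagonal[OF assms(3) ess f e(1) sum' ff e(2) ef(2,1)]
    by blast
qed

end
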